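(* Let $G$ be a connected graph and $\mathcal{B}$ its set of blocks. Let $\emptyset\ne\mathcal{A}\subseteq\mathcal{B}$ be such that $G[\mathcal{A}]$ is connected. Then $\{\mathbf{0},\chi^{\mathcal{A}}\}$ is an edge of $\mathrm{CBP}(G)$ if and only if $|\mathcal{A}|=1$.
   Context: Graphs are finite, simple and undirected. A connected graph is 2-connected if it has at least three vertices and remains connected after deleting any single vertex. A bridge is an edge whose deletion increases the number of connected components. A block of $G$ is a maximal 2-connected subgraph of $G$ or a bridge together with its two end vertices; $\mathcal{B}$ denotes the set of blocks of $G$. For $\mathcal{A}\subseteq\mathcal{B}$ let $G[\mathcal{A}]=\bigcup_{B\in\mathcal{A}}B$ (the empty graph counts as connected), and let $\chi^{\mathcal{A}}\in\{0,1\}^{\mathcal{B}}$ be the incidence vector of $\mathcal{A}$. The connected blocks polytope is $\mathrm{CBP}(G)=\mathrm{conv}\{\chi^{\mathcal{A}}\mid \mathcal{A}\subseteq\mathcal{B},\ G[\mathcal{A}]\text{ connected}\}\subseteq\mathbb{R}^{\mathcal{B}}$. Saying that a pair $\{u,w\}$ of vertices is an edge of a polytope means that the segment $\mathrm{conv}\{u,w\}$ is a 1-dimensional face. *)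

theory Defs
  imports "HOL-Analysis.Analysis" "Graph_Theory.Digraph_Component"
begin

text \<open>
  A finite simple undirected graph is a value satisfying the locale predicate \<^term>\<open>graph\<close>:
  a finite symmetric digraph without loops and parallel arcs, so that an undirected edge
  \<open>uv\<close> is the pair of arcs \<open>u \<rightarrow> v\<close>, \<open>v \<rightarrow> u\<close>.
  The constant \<open>Digraph_Component.connected\<close> excludes the graph without vertices,
  which here counts as connected.
\<close>

definition connected_graph :: "('a, 'e) pre_digraph \<Rightarrow> bool" where
  "connected_graph H \<longleftrightarrow> verts H = {} \<or> Digraph_Component.connected H"

definition two_connected :: "('a, 'e) pre_digraph \<Rightarrow> bool" where
  "two_connected H \<longleftrightarrow> graph H \<and> connected_graph H \<and> card (verts H) \<ge> 3 \<and>
     (\<forall>v \<in> verts H. connected_graph (pre_digraph.del_vert H v))"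

text \<open>The two arcs making up the undirected edge \<open>uv\<close>:\<close>

definition edge_arcs :: "('a, 'e) pre_digraph \<Rightarrow> 'a \<Rightarrow> 'a \<Rightarrow> 'e set" where
  "edge_arcs G u v = {e \<in> arcs G. {tail G e, head G e} = {u, v}}"

text \<open>For a symmetric digraph the strongly connected components \<^term>\<open>pre_digraph.sccs\<close>
  are the connected components of the undirected graph.\<close>

definition bridge :: "('a, 'e) pre_digraph \<Rightarrow> 'a \<Rightarrow> 'a \<Rightarrow> bool" where
  "bridge G u v \<longleftrightarrow> u \<rightarrow>\<^bsub>G\<^esub> v \<and>
     card (pre_digraph.sccs (G\<lparr>arcs := arcs G - edge_arcs G u v\<rparr>)) > card (pre_digraph.sccs G)"

definition edge_graph :: "('a, 'e) pre_digraph \<Rightarrow> 'a \<Rightarrow> 'a \<Rightarrow> ('a, 'e) pre_digraph" where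
  "edge_graph G u v = G\<lparr>verts := {u, v}, arcs := edge_arcs G u v\<rparr>"

definition blocks :: "('a, 'e) pre_digraph \<Rightarrow> ('a, 'e) pre_digraph set" where
  "blocks G = {B. pre_digraph.max_subgraph G two_connected B} \<union>
     {edge_graph G u v | u v. bridge G u v}"

text \<open>
  The space of real vectors indexed by the set of blocks is rendered as \<open>real ^ 'n\<close>, where
  the finite index type \<open>'n\<close> is put in bijection with the set of blocks by a labelling
  \<open>\<beta>\<close>: coordinate \<open>i\<close> belongs to the block \<open>\<beta> i\<close>.
\<close>

definition incidence_vector ::
    "('n::finite \<Rightarrow> ('a, 'e) pre_digraph) \<Rightarrow> ('a, 'e) pre_digraph set \<Rightarrow> real ^ 'n" where
  "incidence_vector \<beta> A = (\<chi> i. if \<beta> i \<in> A then 1 else 0)"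

definition CBP ::
    "('a, 'e) pre_digraph \<Rightarrow> ('n::finite \<Rightarrow> ('a, 'e) pre_digraph) \<Rightarrow> (real ^ 'n) set" where
  "CBP G \<beta> = convex hull
     {incidence_vector \<beta> A | A. A \<subseteq> blocks G \<and> connected_graph (pre_digraph.Union G A)}"

end

theory Submission
  imports Defs
begin

text \<open>
  If \<open>A\<close> has at least two members, then removing a suitable block \<open>B\<close> (a non-cut vertex of the
  intersection graph of \<open>A\<close>) leaves a connected family. The midpoint of \<open>0\<close> and \<open>\<chi>\<^sup>A\<close> is then also
  the midpoint of the incidence vectors of \<open>A - {B}\<close> and \<open>{B}\<close>, which lie off the segment, so the
  segment is not a face. Conversely, for \<open>A = {B}\<close> the segment is an edge of the unit cube, which
  contains the polytope.
\<close>

section \<open>Connectedness in terms of cuts\<close>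

text \<open>A vertex set crossed by no arc is a union of components. This form suits unions of
  graphs: a set uncrossed in the union is uncrossed in every member, so no paths need to be
  glued.\<close>

lemma connected_iff_no_cut:
  assumes "wf_digraph H"
  shows "Digraph_Component.connected H \<longleftrightarrow> verts H \<noteq> {} \<and>
    (\<forall>S. (\<forall>e\<in>arcs H. tail H e \<in> S \<longleftrightarrow> head H e \<in> S) \<longrightarrow> verts H \<subseteq> S \<or> verts H \<inter> S = {})"
    (is "_ \<longleftrightarrow> _ \<and> (\<forall>S. ?closed S \<longrightarrow> _)")
proof -
  interpret wf_digraph H by fact
  let ?R = "rtrancl_on (verts H) ((arcs_ends H)\<^sup>s)"
  have mem: "v \<in> S" if "(u, v) \<in> ?R" "u \<in> S" "?closed S" for u v S
    using that
    by (induction rule: rtrancl_on.induct) (auto simp: symcl_def arcs_ends_conv)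
  \<comment> \<open>The set reachable from \<open>u\<close> serves as the cut for the converse;
    symmetric closure lets each arc be traversed both ways.\<close>
  have closed: "?closed {v. (u, v) \<in> ?R}" for u
  proof
    fix e assume e: "e \<in> arcs H"
    then have "(tail H e, head H e) \<in> (arcs_ends H)\<^sup>s" "(head H e, tail H e) \<in> (arcs_ends H)\<^sup>s"
      by (auto simp: symcl_def arcs_ends_conv)
    with e show "tail H e \<in> {v. (u, v) \<in> ?R} \<longleftrightarrow> head H e \<in> {v. (u, v) \<in> ?R}"
      by (auto intro: rtrancl_on_into_rtrancl_on)
  qed
  show ?thesis
  proof
    assume "Digraph_Component.connected H"
    then show "verts H \<noteq> {} \<and> (\<forall>S. ?closed S \<longrightarrow> verts H \<subseteq> S \<or> verts H \<inter> S = {})"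
      using mem unfolding connected_conv by blast
  next
    assume r: "verts H \<noteq> {} \<and> (\<forall>S. ?closed S \<longrightarrow> verts H \<subseteq> S \<or> verts H \<inter> S = {})"
    have "(u, v) \<in> ?R" if "u \<in> verts H" "v \<in> verts H" for u v
    proof -
      have "(u, u) \<in> ?R" using that by simp
      then show ?thesis using r closed[of u] that by blast
    qed
    then show "Digraph_Component.connected H" using r by (simp add: connected_conv)
  qed
qed

section \<open>Connected unions of subgraphs\<close>

lemma Union_sel:
  "verts (pre_digraph.Union G A) = (\<Union>H\<in>A. verts H)"
  "arcs (pre_digraph.Union G A) = (\<Union>H\<in>A. arcs H)"
  "tail (pre_digraph.Union G A) = tail G"
  "head (pre_digraph.Union G A) = head G"
  by (simp_all add: pre_digraph.Union_def)

lemma subgraph_tail_head: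
  assumes "subgraph H G"
  shows "wf_digraph H" "tail H = tail G" "head H = head G"
  using assms by (auto simp: subgraph_def compatible_def)

lemma wf_digraph_Union:
  assumes "\<And>H. H \<in> A \<Longrightarrow> subgraph H G"
  shows "wf_digraph (pre_digraph.Union G A)"
proof
  fix e assume "e \<in> arcs (pre_digraph.Union G A)"
  then obtain H where "H \<in> A" "e \<in> arcs H" by (auto simp: Union_sel)
  with assms[of H] show "tail (pre_digraph.Union G A) e \<in> verts (pre_digraph.Union G A)"
    "head (pre_digraph.Union G A) e \<in> verts (pre_digraph.Union G A)"
    using subgraph_tail_head[of H G] wf_digraph.wellformed[of H e] by (auto simp: Union_sel)
qed

lemma connected_Union_singleton:
  assumes "subgraph H G" "Digraph_Component.connected H"
  shows "Digraph_Component.connected (pre_digraph.Union G {H})"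
proof -
  \<comment> \<open>The union takes its \<open>tail\<close> and \<open>head\<close> maps from
    \<open>G\<close>; they agree with those of \<open>H\<close> because \<open>H\<close> is a
    subgraph.\<close>
  have "pre_digraph.Union G {H} = H"
    using subgraph_tail_head[OF assms(1)] by (simp add: pre_digraph.Union_def)
  with assms show ?thesis by simp
qed

text \<open>No cut splits \<open>C\<close> or the union over \<open>S\<close>, and a common vertex
  puts both on the same side.\<close>

lemma connected_Union_insert:
  assumes sub: "\<And>H. H \<in> insert C S \<Longrightarrow> subgraph H G"
    and conS: "Digraph_Component.connected (pre_digraph.Union G S)"
    and conC: "Digraph_Component.connected C"
    and meet: "verts C \<inter> (\<Union>H\<in>S. verts H) \<noteq> {}"
  shows "Digraph_Component.connected (pre_digraph.Union G (insert C S))"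
proof -
  have C: "wf_digraph C" "tail C = tail G" "head C = head G"
    using subgraph_tail_head[of C G] sub by auto
  have wfS: "wf_digraph (pre_digraph.Union G S)" by (rule wf_digraph_Union) (use sub in auto)
  have wfI: "wf_digraph (pre_digraph.Union G (insert C S))" by (rule wf_digraph_Union) (use sub in auto)
  show ?thesis
    unfolding connected_iff_no_cut[OF wfI]
  proof (intro conjI allI impI)
    show "verts (pre_digraph.Union G (insert C S)) \<noteq> {}"
      using meet by (auto simp: Union_sel)
  next
    fix T
    assume T: "\<forall>e\<in>arcs (pre_digraph.Union G (insert C S)).
      tail (pre_digraph.Union G (insert C S)) e \<in> T \<longleftrightarrow> head (pre_digraph.Union G (insert C S)) e \<in> T"
    have "verts C \<subseteq> T \<or> verts C \<inter> T = {}"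
      using conC T C unfolding connected_iff_no_cut[OF C(1)] by (simp add: Union_sel)
    moreover have "(\<Union>H\<in>S. verts H) \<subseteq> T \<or> (\<Union>H\<in>S. verts H) \<inter> T = {}"
      using conS[unfolded connected_iff_no_cut[OF wfS]] T
      unfolding Union_sel by blast
    ultimately show "verts (pre_digraph.Union G (insert C S)) \<subseteq> T \<or>
        verts (pre_digraph.Union G (insert C S)) \<inter> T = {}"
      using meet unfolding Union_sel by blast
  qed
qed

text \<open>Otherwise the vertices covered by \<open>S\<close> form a cut: every arc lies in one
  member, which is either in \<open>S\<close> or disjoint from all of \<open>S\<close>.\<close>

lemma connected_Union_meets:
  assumes sub: "\<And>H. H \<in> A \<Longrightarrow> subgraph H G"
    and ne: "\<And>H. H \<in> A \<Longrightarrow> verts H \<noteq> {}"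
    and con: "Digraph_Component.connected (pre_digraph.Union G A)"
    and S: "S \<subset> A" "S \<noteq> {}"
  shows "\<exists>C\<in>A - S. verts C \<inter> (\<Union>H\<in>S. verts H) \<noteq> {}"
proof (rule ccontr)
  assume "\<not> ?thesis"
  then have disj: "verts C \<inter> (\<Union>H\<in>S. verts H) = {}" if "C \<in> A - S" for C
    using that by blast
  let ?T = "\<Union>H\<in>S. verts H"
  have wf: "wf_digraph (pre_digraph.Union G A)" by (rule wf_digraph_Union) (use sub in auto)
  have "tail G e \<in> ?T \<longleftrightarrow> head G e \<in> ?T" if "H \<in> A" "e \<in> arcs H" for H e
  proof -
    have "tail G e \<in> verts H" "head G e \<in> verts H"
      using subgraph_tail_head[OF sub[OF that(1)]] that wf_digraph.wellformed[of H e] by auto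
    then show ?thesis using disj[of H] that by blast
  qed
  then have "\<forall>e\<in>arcs (pre_digraph.Union G A). tail (pre_digraph.Union G A) e \<in> ?T \<longleftrightarrow>
      head (pre_digraph.Union G A) e \<in> ?T"
    unfolding Union_sel by (meson UN_E)
  then have T: "(\<Union>H\<in>A. verts H) \<subseteq> ?T \<or> (\<Union>H\<in>A. verts H) \<inter> ?T = {}"
    using con[unfolded connected_iff_no_cut[OF wf], THEN conjunct2, THEN spec[of _ ?T]]
    by (simp only: Union_sel)
  obtain H where H: "H \<in> S" "H \<in> A" using S by auto
  \<comment> \<open>Vertices of \<open>H\<close> and \<open>C\<close> witness that both sides of the
    cut are inhabited.\<close>
  obtain C where C: "C \<in> A - S" using S by auto
  obtain u v where "u \<in> verts H" "v \<in> verts C"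
    using ne[of H] ne[of C] H C by auto
  then show False using T disj[OF C] H C by blast
qed

text \<open>The member to remove is the one missing from a largest proper connected subfamily.\<close>

lemma connected_Union_remove:
  assumes fin: "finite A" and card: "card A \<ge> 2"
    and sub: "\<And>H. H \<in> A \<Longrightarrow> subgraph H G"
    and con: "\<And>H. H \<in> A \<Longrightarrow> Digraph_Component.connected H"
    and conA: "Digraph_Component.connected (pre_digraph.Union G A)"
  obtains B where "B \<in> A" "Digraph_Component.connected (pre_digraph.Union G (A - {B}))"
proof -
  let ?P = "\<lambda>S. S \<subset> A \<and> S \<noteq> {} \<and> Digraph_Component.connected (pre_digraph.Union G S)"
  obtain H where H: "H \<in> A" using card by fastforce
  \<comment> \<open>Singletons are proper subfamilies since \<open>card A \<ge> 2\<close>, so a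
    largest candidate exists.\<close>
  then have "?P {H}"
    using connected_Union_singleton[OF sub con] card by auto
  moreover have "\<forall>S. ?P S \<longrightarrow> card S < Suc (card A)"
    using fin by (auto intro: less_SucI psubset_card_mono)
  ultimately obtain S where S: "?P S" and max: "\<And>S'. ?P S' \<Longrightarrow> card S' \<le> card S"
    using ex_has_greatest_nat[of ?P "{H}" card "Suc (card A)"] by metis
  have ne: "verts H \<noteq> {}" if "H \<in> A" for H
    using con[OF that] by (simp add: connected_conv)
  obtain C where C: "C \<in> A - S" "verts C \<inter> (\<Union>H\<in>S. verts H) \<noteq> {}"
    using connected_Union_meets[OF sub ne conA, of S] S by metis
  have "Digraph_Component.connected (pre_digraph.Union G (insert C S))"
    by (rule connected_Union_insert) (use S C sub con in auto)
  moreover have "card (insert C S) > card S"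
    using C S fin by (metis DiffD2 card_insert_disjoint finite_subset lessI psubset_imp_subset)
  \<comment> \<open>By maximality of \<open>S\<close> the larger connected family cannot be proper,
    so \<open>C\<close> is the only member outside \<open>S\<close>.\<close>
  ultimately have "insert C S = A"
    using max[of "insert C S"] C S by auto
  then have "A - {C} = S" using C by auto
  then show ?thesis using that[of C] C S by auto
qed

section \<open>Blocks as connected subgraphs\<close>

lemma block_subgraph_connected:
  assumes "graph G" "B \<in> blocks G"
  shows "subgraph B G" "Digraph_Component.connected B"
proof -
  interpret graph G by fact
  have "subgraph B G \<and> Digraph_Component.connected B"
    using assms(2) unfolding blocks_def
  proof
    assume "B \<in> {B. pre_digraph.max_subgraph G two_connected B}"
    then have "subgraph B G" "two_connected B" by (auto simp: pre_digraph.max_subgraph_def)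
    \<comment> \<open>Having at least three vertices rules out the empty graph, which
      \<open>connected_graph\<close> admits.\<close>
    then show ?thesis by (auto simp: two_connected_def connected_graph_def)
  next
    assume "B \<in> {edge_graph G u v | u v. bridge G u v}"
    then obtain u v where B: "B = edge_graph G u v" and uv: "u \<rightarrow>\<^bsub>G\<^esub> v"
      by (auto simp: bridge_def)
    have sel: "verts B = {u, v}" "arcs B = edge_arcs G u v" "tail B = tail G" "head B = head G"
      by (simp_all add: B edge_graph_def)
    have wf: "wf_digraph B"
      by unfold_locales (auto simp: sel edge_arcs_def)
    have "subgraph B G"
      using uv wf by (auto simp: subgraph_def compatible_def sel edge_arcs_def wf_digraph_axioms adj_in_verts)
    moreover obtain e where e: "e \<in> arcs G" "tail G e = u" "head G e = v"
      using uv by (auto simp: arcs_ends_conv)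
    then have "e \<in> arcs B" by (auto simp: sel edge_arcs_def)
    \<comment> \<open>The arc \<open>e\<close> keeps \<open>u\<close> and \<open>v\<close> on the
      same side of every cut.\<close>
    then have "Digraph_Component.connected B"
      unfolding connected_iff_no_cut[OF wf] using e by (auto simp: sel)
    ultimately show ?thesis by simp
  qed
  then show "subgraph B G" "Digraph_Component.connected B" by auto
qed

section \<open>The polytope and the unit cube\<close>

lemma incidence_vector_in_CBP:
  assumes "A \<subseteq> blocks G" "connected_graph (pre_digraph.Union G A)"
  shows "incidence_vector \<beta> A \<in> CBP G \<beta>"
  unfolding CBP_def by (rule hull_inc) (use assms in blast)

lemma zero_in_CBP: "0 \<in> CBP G \<beta>"
proof -
  \<comment> \<open>The origin belongs to the empty family, whose union is the empty graph and
    counts as connected.\<close>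
  have "incidence_vector \<beta> {} = 0" by (simp add: incidence_vector_def vec_eq_iff)
  then show ?thesis
    using incidence_vector_in_CBP[of "{}" G \<beta>] by (simp add: connected_graph_def Union_sel)
qed

lemma CBP_subset_cube: "CBP G \<beta> \<subseteq> cbox 0 1"
  unfolding CBP_def
  by (rule hull_minimal) (auto simp: convex_box mem_box_cart incidence_vector_def)

text \<open>The segment is where all coordinates but \<open>i\<close> attain their minimum 0 on the
  cube.\<close>

lemma unit_segment_face_of_cube:
  fixes i :: "'n::finite"
  shows "convex hull {0, axis i 1 :: real ^ 'n} face_of cbox 0 1"
proof -
  let ?E = "convex hull {0, axis i 1 :: real ^ 'n}"
  have E: "?E = {x. 0 \<le> x $ i \<and> x $ i \<le> 1 \<and> (\<forall>j. j \<noteq> i \<longrightarrow> x $ j = 0)}"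
    (is "_ = ?F")
  proof
    show "?E \<subseteq> ?F"
      by (auto simp: segment_convex_hull[symmetric] in_segment axis_def)
    show "?F \<subseteq> ?E"
    proof
      fix x assume x: "x \<in> ?F"
      then have "x = (x $ i) *\<^sub>R axis i 1" by (auto simp: vec_eq_iff axis_def)
      with x show "x \<in> ?E"
        by (auto simp: segment_convex_hull[symmetric] in_segment intro!: exI[of _ "x $ i"])
    qed
  qed
  have "a \<in> ?F \<and> b \<in> ?F"
    if ab: "a \<in> cbox 0 1" "b \<in> cbox 0 1" and x: "x \<in> ?F" "x \<in> open_segment a b" for a b x
  proof -
    obtain t where t: "0 < t" "t < 1" "x = (1 - t) *\<^sub>R a + t *\<^sub>R b"
      using x(2) by (auto simp: in_segment)
    have "a $ j = 0 \<and> b $ j = 0" if "j \<noteq> i" for j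
    proof -
      \<comment> \<open>Both weights are positive and both entries nonnegative, so each entry
        vanishes.\<close>
      have "(1 - t) * a $ j + t * b $ j = 0" using x(1) t(3) that by auto
      moreover have "0 \<le> a $ j" "0 \<le> b $ j" using ab by (auto simp: mem_box_cart)
      ultimately show ?thesis using t(1,2) by (simp add: add_nonneg_eq_0_iff)
    qed
    then show ?thesis using ab by (auto simp: mem_box_cart)
  qed
  moreover have "?F \<subseteq> cbox 0 1"
  proof
    fix x :: "real ^ 'n" assume "x \<in> ?F"
    then show "x \<in> cbox 0 1"
      unfolding mem_box_cart
      by (metis (mono_tags, lifting) mem_Collect_eq order_refl zero_index one_index zero_le_one)
  qed
  moreover have "convex ?F" unfolding E[symmetric] by (rule convex_convex_hull)
  ultimately show ?thesis unfolding E face_of_def by blast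
qed

section \<open>Edges at the origin\<close>

theorem theorem6p1:
  fixes G :: "('a, 'e) pre_digraph"
    and \<beta> :: "'n::finite \<Rightarrow> ('a, 'e) pre_digraph"
    and A :: "('a, 'e) pre_digraph set"
  assumes "graph G"
    and "connected_graph G"
    and "bij_betw \<beta> UNIV (blocks G)"
    and "A \<noteq> {}"
    and "A \<subseteq> blocks G"
    and "connected_graph (pre_digraph.Union G A)"
  shows "(convex hull {0, incidence_vector \<beta> A}) edge_of CBP G \<beta> \<longleftrightarrow> card A = 1"
proof
  assume "card A = 1"
  then obtain B where B: "A = {B}" by (auto simp: card_1_singleton_iff)
  with assms(3,5) obtain i where i: "\<beta> i = B"
    by (metis bij_betw_iff_bijections insert_subset)
  \<comment> \<open>Injectivity leaves \<open>i\<close> as the only coordinate labelled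
    \<open>B\<close>, so the incidence vector is a unit vector.\<close>
  have inj: "\<beta> j = \<beta> k \<longleftrightarrow> j = k" for j k
    using assms(3) by (auto simp: bij_betw_def inj_eq)
  have ax: "incidence_vector \<beta> A = axis i 1"
    by (auto simp: incidence_vector_def axis_def vec_eq_iff B inj simp flip: i)
  have "convex hull {0, incidence_vector \<beta> A} \<subseteq> CBP G \<beta>"
    by (rule hull_minimal)
      (use zero_in_CBP incidence_vector_in_CBP[OF assms(5,6)] in \<open>auto simp: CBP_def\<close>)
  \<comment> \<open>A face of the cube that lies in the polytope is a face of the polytope, which is
    itself contained in the cube.\<close>
  then have "convex hull {0, incidence_vector \<beta> A} face_of CBP G \<beta>"
    using face_of_subset[OF unit_segment_face_of_cube _ CBP_subset_cube] unfolding ax by metis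
  moreover have "aff_dim (convex hull {0, incidence_vector \<beta> A}) = 1"
    by (simp add: aff_dim_convex_hull aff_dim_2 ax axis_eq_0_iff)
  ultimately show "(convex hull {0, incidence_vector \<beta> A}) edge_of CBP G \<beta>"
    by (simp add: edge_of_def)
next
  assume "(convex hull {0, incidence_vector \<beta> A}) edge_of CBP G \<beta>"
  then have face: "closed_segment 0 (incidence_vector \<beta> A) face_of CBP G \<beta>"
    by (simp add: edge_of_def segment_convex_hull)
  have fin: "finite A"
    using assms(3,5) by (metis bij_betw_finite finite_class.finite_UNIV finite_subset)
  have blk: "subgraph H G" "Digraph_Component.connected H" if "H \<in> A" for H
    using block_subgraph_connected[OF assms(1)] assms(5) that by auto
  show "card A = 1"
  proof (rule ccontr)
    assume "card A \<noteq> 1"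
    with fin assms(4) have card: "card A \<ge> 2"
      by (metis One_nat_def Suc_1 Suc_leI card_gt_0_iff le_neq_implies_less)
    \<comment> \<open>Blocks have vertices, so the empty-graph case of
      \<open>connected_graph\<close> does not occur.\<close>
    have "verts (pre_digraph.Union G A) \<noteq> {}"
      using assms(4) blk by (auto simp: Union_sel connected_conv)
    then have "Digraph_Component.connected (pre_digraph.Union G A)"
      using assms(6) by (simp add: connected_graph_def)
    then obtain B where B: "B \<in> A" "Digraph_Component.connected (pre_digraph.Union G (A - {B}))"
      using connected_Union_remove[OF fin card blk] by metis
    define x where "x = incidence_vector \<beta> {B}"
    define y where "y = incidence_vector \<beta> (A - {B})"
    have x: "x \<in> CBP G \<beta>"
      unfolding x_def using B(1) assms(5) connected_Union_singleton[OF blk]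
      by (intro incidence_vector_in_CBP) (auto simp: connected_graph_def)
    have y: "y \<in> CBP G \<beta>"
      unfolding y_def using B(2) assms(5)
      by (intro incidence_vector_in_CBP) (auto simp: connected_graph_def)
    have "card (A - {B}) \<noteq> 0" using B(1) card by simp
    then have "A - {B} \<noteq> {}" by (metis card.empty)
    then obtain C where C: "C \<in> A" "C \<noteq> B" by auto
    \<comment> \<open>These two coordinates differ on \<open>x\<close> but agree on every multiple
      of \<open>incidence_vector \<beta> A\<close>.\<close>
    obtain i j where ij: "\<beta> i = B" "\<beta> j = C"
      using B(1) C(1) assms(3,5) by (metis bij_betw_iff_bijections subsetD)
    have coord: "x $ i = 1" "x $ j = 0" "y $ i = 0"
      "incidence_vector \<beta> A $ i = 1" "incidence_vector \<beta> A $ j = 1"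
      using ij B(1) C by (auto simp: x_def y_def incidence_vector_def)
    then have "x \<noteq> y" by auto
    have "midpoint x y = midpoint 0 (incidence_vector \<beta> A)"
      using B(1) by (auto simp: x_def y_def midpoint_def incidence_vector_def vec_eq_iff)
    then have "midpoint x y \<in> closed_segment 0 (incidence_vector \<beta> A)"
      by simp
    moreover have "midpoint x y \<in> open_segment x y"
      using \<open>x \<noteq> y\<close> by simp
    \<comment> \<open>A face containing an interior point of the segment from \<open>x\<close> to
      \<open>y\<close> contains its endpoints.\<close>
    ultimately have "x \<in> closed_segment 0 (incidence_vector \<beta> A)"
      using face x y unfolding face_of_def by blast
    \<comment> \<open>The scalar \<open>t\<close> would have to be 1 by coordinate \<open>i\<close>
      and 0 by coordinate \<open>j\<close>.\<close>
    then obtain t where "x = t *\<^sub>R incidence_vector \<beta> A" by (auto simp: in_segment)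
    then have "x $ i = t" "x $ j = t" using coord by auto
    with coord show False by simp
  qed
qed

end
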